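(* Let $G=([n],E,w)$ be a connected graph with positive edge weights $w:E\to\mathbb{R}_{>0}$, and let $L=D-A$ be its combinatorial Laplacian. Suppose $L$ has $m$ distinct eigenspaces, listed in an order $\Lambda_1<\Lambda_2<\cdots<\Lambda_m$ in which $\Lambda_1=\operatorname{span}\{\mathbbm{1}\}$ (the eigenspace of eigenvalue $0$) comes first. Let $U\in\mathbb{R}^{n\times n}$ be a matrix whose rows form an orthogonal basis of $\mathbb{R}^n$ consisting of eigenvectors of $L$, each row lying in one of the eigenspaces, with the row for $\Lambda_1$ equal to $\mathbbm{1}$. For an integer $k$, let $\overline{\boldsymbol{k}}=\{1,k+1,\ldots,m\}$, let $U_{\overline{\boldsymbol{k}}}$ be the submatrix of $U$ consisting of the rows lying in $\Lambda_i$ for $i\in\overline{\boldsymbol{k}}$, let $u_1,\dots,u_n$ be the columns of $U_{\overline{\boldsymbol{k}}}$, and let $P_{\overline{\boldsymbol{k}}}=\operatorname{conv}\{u_1,\ldots,u_n\}$. Then a set $S\subseteq[n]$ is a positively weighted $k$-graphical design of $G$ if and only if $[n]\setminus S=\{i\in[n]: u_i\in F\}$ for some face $F$ of $P_{\overline{\boldsymbol{k}}}$. Moreover, $S$ is a minimal positively weighted $k$-graphical design if and only if $[n]\setminus S=\{i\in[n]: u_i\in F\}$ for some facet $F$ of $P_{\overline{\boldsymbol{k}}}$.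
   Context: The weighted adjacency matrix $A$ has $A_{ij}=w(ij)$ if $ij\in E$ and $0$ otherwise; $D$ is diagonal with $D_{ii}=\sum_{ij\in E}w(ij)$. A subset $S\subseteq[n]$ averages an eigenspace $\Lambda$ with vertex weights $(a_s\neq 0: s\in S)$ if for every eigenvector $\phi$ in a basis of $\Lambda$, $\sum_{s\in S}a_s\phi(s)=\frac1n\sum_{v\in[n]}\phi(v)$. A positively weighted $k$-graphical design is a subset $S\subseteq[n]$ together with weights $a_s>0$ ($s\in S$) such that $S$ averages each of $\Lambda_1,\ldots,\Lambda_k$ with these weights (design weights are considered only up to positive scaling). A design is minimal if its support $S$ is minimal with respect to inclusion among supports of positively weighted $k$-graphical designs.
   Formalization: The face F is required to be proper (F ≠ P, the empty face allowed), since F = P would give S = ∅, which is not a design; k is taken with 1 ≤ k ≤ m, and the empty face counts as the facet of a one-point polytope (k = m). *)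

theory Defs
  imports "HOL-Analysis.Analysis"
begin

text \<open>The vertex set \<open>[n]\<close> is a finite type \<open>'n\<close>, so \<open>n = CARD('n)\<close>; functions on
  the vertices are vectors in \<open>real ^ 'n\<close>. Edges are two-element sets of vertices.\<close>

definition weighted_graph :: "'n set set \<Rightarrow> ('n set \<Rightarrow> real) \<Rightarrow> bool" where
  "weighted_graph E w \<longleftrightarrow> (\<forall>e\<in>E. card e = 2) \<and> (\<forall>e\<in>E. 0 < w e)"

definition graph_connected :: "'n set set \<Rightarrow> bool" where
  "graph_connected E \<longleftrightarrow> (\<forall>u v. (u, v) \<in> {(x, y). {x, y} \<in> E}\<^sup>*)"

definition adjacency_matrix :: "'n::finite set set \<Rightarrow> ('n set \<Rightarrow> real) \<Rightarrow> real ^ 'n ^ 'n" where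
  "adjacency_matrix E w = (\<chi> i j. if {i, j} \<in> E then w {i, j} else 0)"

definition degree_matrix :: "'n::finite set set \<Rightarrow> ('n set \<Rightarrow> real) \<Rightarrow> real ^ 'n ^ 'n" where
  "degree_matrix E w = (\<chi> i j. if i = j then \<Sum>l\<in>{l. {i, l} \<in> E}. w {i, l} else 0)"

definition laplacian :: "'n::finite set set \<Rightarrow> ('n set \<Rightarrow> real) \<Rightarrow> real ^ 'n ^ 'n" where
  "laplacian E w = degree_matrix E w - adjacency_matrix E w"

definition eigenspace :: "real ^ 'n ^ 'n \<Rightarrow> real \<Rightarrow> (real ^ 'n) set" where
  "eigenspace M \<mu> = {x. M *v x = \<mu> *\<^sub>R x}"

definition is_eigenvalue :: "real ^ 'n ^ 'n \<Rightarrow> real \<Rightarrow> bool" where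
  "is_eigenvalue M \<mu> \<longleftrightarrow> (\<exists>x. x \<noteq> 0 \<and> M *v x = \<mu> *\<^sub>R x)"

definition eigenspaces :: "real ^ 'n ^ 'n \<Rightarrow> (real ^ 'n) set set" where
  "eigenspaces M = {eigenspace M \<mu> | \<mu>. is_eigenvalue M \<mu>}"

definition eigenspace_order :: "real ^ 'n ^ 'n \<Rightarrow> nat \<Rightarrow> (nat \<Rightarrow> (real ^ 'n) set) \<Rightarrow> bool" where
  "eigenspace_order M m \<Lambda> \<longleftrightarrow>
     card (eigenspaces M) = m \<and> bij_betw \<Lambda> {1..m} (eigenspaces M) \<and> \<Lambda> 1 = span {1}"

definition orthogonal_eigenbasis_matrix ::
    "nat \<Rightarrow> (nat \<Rightarrow> (real ^ 'n) set) \<Rightarrow> real ^ 'n ^ 'n \<Rightarrow> bool" where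
  "orthogonal_eigenbasis_matrix m \<Lambda> U \<longleftrightarrow>
     (\<forall>i j. i \<noteq> j \<longrightarrow> orthogonal (row i U) (row j U)) \<and>
     independent (rows U) \<and> span (rows U) = UNIV \<and>
     (\<forall>i. \<exists>j\<in>{1..m}. row i U \<in> \<Lambda> j) \<and>
     (\<forall>i. row i U \<in> \<Lambda> 1 \<longrightarrow> row i U = 1)"

definition averages :: "'n::finite set \<Rightarrow> ('n \<Rightarrow> real) \<Rightarrow> (real ^ 'n) set \<Rightarrow> bool" where
  "averages S a \<Lambda> \<longleftrightarrow>
     (\<forall>s\<in>S. a s \<noteq> 0) \<and>
     (\<exists>B. B \<subseteq> \<Lambda> \<and> independent B \<and> span B = \<Lambda> \<and>
        (\<forall>\<phi>\<in>B. (\<Sum>s\<in>S. a s * \<phi> $ s) = (1 / real CARD('n)) * (\<Sum>v\<in>UNIV. \<phi> $ v)))"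

text \<open>The choice of basis in \<open>averages\<close> is immaterial.\<close>

lemma averages_iff_all:
  fixes \<Lambda> :: "(real ^ 'n) set"
  assumes "subspace \<Lambda>"
  shows "averages S a \<Lambda> \<longleftrightarrow> (\<forall>s\<in>S. a s \<noteq> 0) \<and>
    (\<forall>\<phi>\<in>\<Lambda>. (\<Sum>s\<in>S. a s * \<phi> $ s) = (1 / real CARD('n)) * (\<Sum>v\<in>UNIV. \<phi> $ v))"
proof -
  define f where "f = (\<lambda>\<phi> :: real ^ 'n. \<Sum>s\<in>S. a s * \<phi> $ s)"
  define g where "g = (\<lambda>\<phi> :: real ^ 'n. (1 / real CARD('n)) * (\<Sum>v\<in>UNIV. \<phi> $ v))"
  have "linear f"
    by (rule linearI) (simp_all add: f_def distrib_left sum.distrib sum_distrib_left mult.left_commute)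
  have "linear g"
    by (rule linearI) (simp_all add: g_def add_divide_distrib sum.distrib sum_distrib_left)
  have span: "\<forall>\<phi>\<in>span B. f \<phi> = g \<phi>" if "\<forall>\<phi>\<in>B. f \<phi> = g \<phi>" for B
    using that linear_eq_on_span[OF \<open>linear f\<close> \<open>linear g\<close>, of B] by simp
  obtain B where B: "B \<subseteq> \<Lambda>" "independent B" "\<Lambda> \<subseteq> span B"
    by (rule basis_exists)
  have "span B = \<Lambda>"
    using B(1,3) assms by (simp add: span_minimal subset_antisym)
  have "(\<exists>B. B \<subseteq> \<Lambda> \<and> independent B \<and> span B = \<Lambda> \<and> (\<forall>\<phi>\<in>B. f \<phi> = g \<phi>))
      \<longleftrightarrow> (\<forall>\<phi>\<in>\<Lambda>. f \<phi> = g \<phi>)" (is "?L \<longleftrightarrow> ?R")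
  proof
    assume ?L
    then obtain C where "span C = \<Lambda>" "\<forall>\<phi>\<in>C. f \<phi> = g \<phi>" by (elim exE conjE)
    then show ?R using span[of C] by simp
  next
    assume ?R
    with B(1) have "\<forall>\<phi>\<in>B. f \<phi> = g \<phi>" by (simp add: subset_iff)
    with B(1,2) \<open>span B = \<Lambda>\<close> show ?L by (intro exI[of _ B] conjI)
  qed
  then show ?thesis
    unfolding averages_def f_def g_def by (rule conj_cong[OF refl])
qed

text \<open>The weights in a design are normalised by averaging \<open>\<Lambda> 1 = span {1}\<close>, which forces
  their sum to be 1; in particular the empty set is not a design.\<close>

definition positive_design :: "(nat \<Rightarrow> (real ^ 'n::finite) set) \<Rightarrow> nat \<Rightarrow> 'n set \<Rightarrow> bool" where
  "positive_design \<Lambda> k S \<longleftrightarrow>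
     (\<exists>a. (\<forall>s\<in>S. 0 < a s) \<and> (\<forall>i\<in>{1..k}. averages S a (\<Lambda> i)))"

definition minimal_positive_design ::
    "(nat \<Rightarrow> (real ^ 'n::finite) set) \<Rightarrow> nat \<Rightarrow> 'n set \<Rightarrow> bool" where
  "minimal_positive_design \<Lambda> k S \<longleftrightarrow>
     positive_design \<Lambda> k S \<and> \<not> (\<exists>T. T \<subset> S \<and> positive_design \<Lambda> k T)"

definition kbar :: "nat \<Rightarrow> nat \<Rightarrow> nat set" where
  "kbar m k = {1} \<union> {k + 1..m}"

definition selected_rows ::
    "nat \<Rightarrow> (nat \<Rightarrow> (real ^ 'n) set) \<Rightarrow> real ^ 'n ^ 'n \<Rightarrow> nat \<Rightarrow> 'n set" where
  "selected_rows m \<Lambda> U k = {i. \<exists>j\<in>kbar m k. row i U \<in> \<Lambda> j}"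

text \<open>The number of rows of the submatrix depends on \<open>k\<close>; its rows are indexed by a finite
  type \<open>'r\<close>, and \<open>\<rho>\<close> (a bijection onto the selected rows wherever it is used) tells
  which row of \<open>U\<close> each of them is. The order of the rows is irrelevant.\<close>

definition row_submatrix :: "real ^ 'n ^ 'n \<Rightarrow> ('r \<Rightarrow> 'n) \<Rightarrow> real ^ 'n ^ 'r" where
  "row_submatrix U \<rho> = (\<chi> p v. U $ \<rho> p $ v)"

definition design_polytope :: "real ^ 'n ^ 'r \<Rightarrow> (real ^ 'r) set" where
  "design_polytope V = convex hull (range (\<lambda>v. column v V))"

text \<open>A facet is a face of codimension one. In contrast to the library's \<open>facet_of\<close>, the empty
  face (of dimension \<open>-1\<close>) of a single point counts as a facet; this is the only difference,
  and it matters only for \<open>k = m\<close>, where the polytope is a point.\<close>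

definition polytope_facet :: "'a::euclidean_space set \<Rightarrow> 'a set \<Rightarrow> bool" where
  "polytope_facet F P \<longleftrightarrow> F face_of P \<and> aff_dim F = aff_dim P - 1"

lemma polytope_facet_iff_facet_of:
  "aff_dim P \<noteq> 0 \<Longrightarrow> polytope_facet F P \<longleftrightarrow> F facet_of P"
  by (auto simp: polytope_facet_def facet_of_def)

end

theory Submission
  imports Defs
begin

text \<open>Extend the weights of a design by zero to a vector \<open>a\<close> on the vertices. Averaging
  \<open>\<Lambda> 1\<close> fixes the sum of \<open>a\<close> to be 1, and averaging \<open>\<Lambda> 2\<close>, ..., \<open>\<Lambda> k\<close> says that \<open>a\<close> is
  orthogonal to them, that is, \<open>a\<close> lies in the row space of \<open>V\<close>: \<open>a v = c \<bullet> u v\<close> for some \<open>c\<close>,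
  where \<open>u v\<close> are the columns of \<open>V\<close>. So designs are the sets on which a linear functional that
  is nonnegative on all columns is positive. Because one row of \<open>V\<close> is constantly 1, an affine
  functional on the columns is linear, and these sets are the complements of the proper (exposed)
  faces of the polytope. Passing to complements reverses inclusion, and the maximal proper faces
  are the facets.\<close>

section \<open>Faces of the convex hull of a finite family\<close>

lemma polytope_convex_hull_range:
  fixes u :: "'n::finite \<Rightarrow> 'a::euclidean_space"
  shows "polytope (convex hull (range u))"
  unfolding polytope_def by (intro exI[of _ "range u"]) simp

text \<open>A face of a polytope is the convex hull of the generators lying in it, so it is
  determined by their indices. This lets inclusions of vertex sets be read as inclusions of
  faces.\<close>

lemma face_of_convex_hull_range_mono:
  fixes u :: "'n::finite \<Rightarrow> 'a::euclidean_space"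
  assumes F: "F face_of convex hull (range u)" and G: "G face_of convex hull (range u)"
    and sub: "{i. u i \<in> F} \<subseteq> {i. u i \<in> G}"
  shows "F \<subseteq> G"
proof -
  have "compact (range u)" by (simp add: finite_imp_compact)
  then obtain X where X: "X \<subseteq> range u" "F = convex hull X"
    using face_of_convex_hull_subset[OF _ F] by blast
  have "X \<subseteq> G"
  proof
    fix x assume "x \<in> X"
    with X obtain i where "x = u i" "u i \<in> F" by (metis hull_inc imageE subset_iff)
    then show "x \<in> G" using sub by auto
  qed
  then show ?thesis
    unfolding X(2) using G by (intro hull_minimal) (auto simp: face_of_imp_convex)
qed

text \<open>Faces of a polytope are exposed, so each is the zero set on \<open>P\<close> of an
  affine functional that is nonnegative there. The vector \<open>e\<close> plays the constant
  function 1 on the points \<open>u v\<close>, which makes the functional linear. The condition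
  \<open>F \<noteq> P\<close> corresponds to \<open>S \<noteq> {}\<close>: a face containing all
  generators is the whole polytope.\<close>

lemma proper_face_iff_nonneg_functional:
  fixes u :: "'n::finite \<Rightarrow> 'a::euclidean_space"
  assumes e: "\<And>v. e \<bullet> u v = 1" and P: "P = convex hull (range u)"
  shows "(\<exists>F. F face_of P \<and> F \<noteq> P \<and> UNIV - S = {i. u i \<in> F}) \<longleftrightarrow>
    (\<exists>c. (\<forall>v. 0 \<le> c \<bullet> u v) \<and> S = {v. 0 < c \<bullet> u v} \<and> S \<noteq> {})"
proof
  assume "\<exists>F. F face_of P \<and> F \<noteq> P \<and> UNIV - S = {i. u i \<in> F}"
  then obtain F where F: "F face_of P" "F \<noteq> P" "UNIV - S = {i. u i \<in> F}" by blast
  have "polyhedron P"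
    unfolding P by (intro polytope_imp_polyhedron polytope_convex_hull_range)
  with F(1) have "F exposed_face_of P" by (simp add: exposed_face_of_polyhedron)
  then obtain a b where ab: "P \<subseteq> {x. a \<bullet> x \<le> b}" "F = P \<inter> {x. a \<bullet> x = b}"
    unfolding exposed_face_of_def by blast
  have uP: "u v \<in> P" for v unfolding P by (simp add: hull_inc)
  \<comment> \<open>By \<open>e\<close>, the constant \<open>b\<close> equals
    \<open>b *\<^sub>R e\<close> paired with any \<open>u v\<close>, so \<open>?c\<close> measures
    the slack of \<open>u v\<close> in the supporting inequality.\<close>
  let ?c = "b *\<^sub>R e - a"
  have c: "?c \<bullet> u v = b - a \<bullet> u v" for v by (simp add: inner_diff_left e)
  have le: "a \<bullet> u v \<le> b" for v using ab(1) uP by blast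
  have S: "S = {v. 0 < ?c \<bullet> u v}"
  proof -
    have "v \<in> S \<longleftrightarrow> a \<bullet> u v \<noteq> b" for v
    proof -
      have "v \<notin> S \<longleftrightarrow> u v \<in> F" using F(3) by blast
      then show ?thesis unfolding ab(2) using uP[of v] by blast
    qed
    then show ?thesis unfolding c using le by (auto simp: less_le)
  qed
  have "S \<noteq> {}"
  proof
    assume "S = {}"
    then have "range u \<subseteq> F" using F(3) by auto
    then have "P \<subseteq> F"
      unfolding P using F(1) by (intro hull_minimal) (auto simp: face_of_imp_convex)
    then show False using F(1,2) face_of_imp_subset by blast
  qed
  then show "\<exists>c. (\<forall>v. 0 \<le> c \<bullet> u v) \<and> S = {v. 0 < c \<bullet> u v} \<and> S \<noteq> {}"
    using S le c by (intro exI[of _ ?c]) auto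
next
  assume "\<exists>c. (\<forall>v. 0 \<le> c \<bullet> u v) \<and> S = {v. 0 < c \<bullet> u v} \<and> S \<noteq> {}"
  then obtain c where c: "\<And>v. 0 \<le> c \<bullet> u v" "S = {v. 0 < c \<bullet> u v}" "S \<noteq> {}" by blast
  \<comment> \<open>The hyperplane where \<open>c\<close> vanishes supports \<open>P\<close>, since
    nonnegativity passes from the generators to their hull.\<close>
  let ?F = "P \<inter> {x. c \<bullet> x = 0}"
  have uP: "u v \<in> P" for v unfolding P by (simp add: hull_inc)
  have "P \<subseteq> {x. c \<bullet> x \<ge> 0}"
    unfolding P using c(1) by (intro hull_minimal) (auto simp: convex_halfspace_ge)
  then have face: "?F face_of P"
    by (intro face_of_Int_supporting_hyperplane_ge) (auto simp: P)
  have idx: "u v \<in> ?F \<longleftrightarrow> v \<notin> S" for v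
    using uP[of v] c(1)[of v] unfolding c(2) by auto
  have "?F \<noteq> P" using c(3) idx uP by blast
  with face idx show "\<exists>F. F face_of P \<and> F \<noteq> P \<and> UNIV - S = {i. u i \<in> F}"
    by (intro exI[of _ ?F]) auto
qed

text \<open>The library theorem provides a facet around a nonempty proper face. The empty face is
  treated apart: if \<open>P\<close> is a point it is itself a facet in the sense of
  \<open>polytope_facet\<close>, and otherwise any facet contains it.\<close>

lemma proper_face_subset_polytope_facet:
  assumes P: "polytope P" and F: "F face_of P" "F \<noteq> P"
  obtains G where "polytope_facet G P" "F \<subseteq> G"
proof -
  have "P \<noteq> {}" using F by auto
  have cP: "compact P" "convex P" using P by (simp_all add: polytope_imp_compact polytope_imp_convex)
  consider "F \<noteq> {}" | "F = {}" "aff_dim P = 0" | "F = {}" "aff_dim P \<noteq> 0" by blast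
  then show ?thesis
  proof cases
    case 1
    then obtain G where "G facet_of P" "F \<subseteq> G"
      using face_of_polyhedron_subset_facet[OF polytope_imp_polyhedron[OF P] F(1) _ F(2)] by blast
    then show ?thesis using that[of G] by (auto simp: polytope_facet_def facet_of_def)
  next
    case 2
    then show ?thesis using that[of F] F(1) by (auto simp: polytope_facet_def)
  next
    case 3
    \<comment> \<open>To see that some facet exists, the empty face is replaced by a vertex, which
      is a proper face because \<open>P\<close> is not a point.\<close>
    obtain x where "x extreme_point_of P"
      using extreme_point_exists_convex[OF cP \<open>P \<noteq> {}\<close>] by blast
    then have x: "{x} face_of P" by (simp add: face_of_singleton)
    moreover have "{x} \<noteq> P" using 3 aff_dim_sing by metis
    ultimately obtain G where "G facet_of P"
      using face_of_polyhedron_subset_facet[OF polytope_imp_polyhedron[OF P] x] by blast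
    then show ?thesis using that[of G] 3 by (auto simp: polytope_facet_def facet_of_def)
  qed
qed

text \<open>Strict inclusion of faces strictly raises the dimension, and no integer lies strictly
  between the dimensions of \<open>F\<close> and \<open>P\<close>.\<close>

lemma polytope_facet_maximal:
  assumes P: "convex P" and F: "polytope_facet F P" and G: "G face_of P" "G \<noteq> P" "F \<subseteq> G"
  shows "G = F"
proof (rule ccontr)
  assume "G \<noteq> F"
  have "F face_of G"
    using F G face_of_subset face_of_imp_subset unfolding polytope_facet_def by metis
  then have "aff_dim F < aff_dim G"
    using \<open>G \<noteq> F\<close> face_of_imp_convex[OF G(1)] by (metis face_of_aff_dim_lt)
  moreover have "aff_dim G < aff_dim P" using P G face_of_aff_dim_lt by blast
  ultimately show False using F unfolding polytope_facet_def by linarith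
qed

text \<open>Complementation turns minimal supports into maximal index sets of proper faces.
  Enlarging a proper face to a facet gives one direction; for the other, a smaller support would
  give a proper face strictly above a facet.\<close>

lemma minimal_complement_of_proper_face_iff_facet:
  fixes u :: "'n::finite \<Rightarrow> 'a::euclidean_space"
  assumes P: "P = convex hull (range u)"
    and Q: "\<And>S. Q S \<longleftrightarrow> (\<exists>F. F face_of P \<and> F \<noteq> P \<and> UNIV - S = {i. u i \<in> F})"
  shows "Q S \<and> \<not> (\<exists>T. T \<subset> S \<and> Q T) \<longleftrightarrow>
    (\<exists>F. polytope_facet F P \<and> UNIV - S = {i. u i \<in> F})"
proof (intro iffI)
  assume S: "Q S \<and> \<not> (\<exists>T. T \<subset> S \<and> Q T)"
  then obtain F where F: "F face_of P" "F \<noteq> P" "UNIV - S = {i. u i \<in> F}" using Q by blast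
  have "polytope P" unfolding P by (rule polytope_convex_hull_range)
  then obtain G where G: "polytope_facet G P" "F \<subseteq> G"
    using proper_face_subset_polytope_facet F(1,2) by blast
  then have "G face_of P" "G \<noteq> P" by (auto simp: polytope_facet_def)
  then have "Q (UNIV - {i. u i \<in> G})" using Q by blast
  moreover have "UNIV - {i. u i \<in> G} \<subseteq> S" using F(3) G(2) by blast
  ultimately have "UNIV - {i. u i \<in> G} = S" using S by blast
  then show "\<exists>F. polytope_facet F P \<and> UNIV - S = {i. u i \<in> F}" using G(1) by blast
next
  assume "\<exists>F. polytope_facet F P \<and> UNIV - S = {i. u i \<in> F}"
  then obtain F where F: "polytope_facet F P" "UNIV - S = {i. u i \<in> F}" by blast
  then have face: "F face_of P" "F \<noteq> P" by (auto simp: polytope_facet_def)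
  have "\<not> Q T" if T: "T \<subset> S" for T
  proof
    assume "Q T"
    then obtain G where G: "G face_of P" "G \<noteq> P" "UNIV - T = {i. u i \<in> G}" using Q by blast
    have "{i. u i \<in> F} \<subset> {i. u i \<in> G}" unfolding F(2)[symmetric] G(3)[symmetric] using T by blast
    moreover from this have "F \<subseteq> G"
      using face_of_convex_hull_range_mono face(1) G(1) unfolding P by blast
    then have "G = F" using polytope_facet_maximal[OF _ F(1) G(1,2)] P by simp
    ultimately show False by simp
  qed
  then show "Q S \<and> \<not> (\<exists>T. T \<subset> S \<and> Q T)" using Q face F(2) by blast
qed

section \<open>Eigenspaces of the Laplacian\<close>

lemma laplacian_symmetric: "transpose (laplacian E w) = laplacian E w"
proof -
  have "{i, j} = {j, i}" for i j :: 'a by blast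
  then show ?thesis
    by (auto simp: laplacian_def degree_matrix_def adjacency_matrix_def transpose_def vec_eq_iff)
qed

lemma subspace_eigenspace: "subspace (eigenspace M \<mu>)"
  by (auto simp: eigenspace_def subspace_def matrix_vector_right_distrib scaleR_right_distrib
      matrix_vector_mult_scaleR mult.commute)

lemma orthogonal_eigenspaces:
  assumes M: "transpose M = M" and x: "x \<in> eigenspace M \<mu>" and y: "y \<in> eigenspace M \<nu>"
    and "\<mu> \<noteq> \<nu>"
  shows "x \<bullet> y = 0"
proof -
  have "\<mu> * (x \<bullet> y) = (M *v x) \<bullet> y" using x by (simp add: eigenspace_def)
  also have "\<dots> = x \<bullet> (M *v y)" by (metis M dot_lmul_matrix vector_transpose_matrix inner_commute)
  also have "\<dots> = \<nu> * (x \<bullet> y)" using y by (simp add: eigenspace_def)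
  finally show ?thesis using \<open>\<mu> \<noteq> \<nu>\<close> by simp
qed

lemma eigenspace_orderD:
  assumes L: "eigenspace_order M m \<Lambda>" and M: "transpose M = M"
  shows eigenspace_order_subspace: "i \<in> {1..m} \<Longrightarrow> subspace (\<Lambda> i)"
    and eigenspace_order_orthogonal:
      "\<lbrakk>i \<in> {1..m}; j \<in> {1..m}; i \<noteq> j; x \<in> \<Lambda> i; y \<in> \<Lambda> j\<rbrakk> \<Longrightarrow> x \<bullet> y = 0"
proof -
  have bij: "bij_betw \<Lambda> {1..m} (eigenspaces M)" using L by (simp add: eigenspace_order_def)
  have ex: "\<exists>\<mu>. \<Lambda> i = eigenspace M \<mu>" if "i \<in> {1..m}" for i
    using bij_betwE[OF bij] that unfolding eigenspaces_def by blast
  show "subspace (\<Lambda> i)" if "i \<in> {1..m}" using ex[OF that] subspace_eigenspace by auto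
  show "x \<bullet> y = 0" if ij: "i \<in> {1..m}" "j \<in> {1..m}" "i \<noteq> j" and xy: "x \<in> \<Lambda> i" "y \<in> \<Lambda> j"
  proof -
    obtain \<mu> \<nu> where \<mu>: "\<Lambda> i = eigenspace M \<mu>" and \<nu>: "\<Lambda> j = eigenspace M \<nu>"
      using ex[OF ij(1)] ex[OF ij(2)] by blast
    \<comment> \<open>Injectivity of the enumeration is what makes the two eigenvalues
      different.\<close>
    have "\<Lambda> i \<noteq> \<Lambda> j" using inj_onD[OF bij_betw_imp_inj_on[OF bij]] ij by blast
    then have "\<mu> \<noteq> \<nu>" using \<mu> \<nu> by auto
    then show ?thesis using orthogonal_eigenspaces[OF M] xy \<mu> \<nu> by simp
  qed
qed

text \<open>The difference of the two sides is orthogonal to every row, hence to the whole space and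
  so to itself.\<close>

lemma orthogonal_basis_expansion:
  fixes U :: "real ^ 'n ^ 'm::finite" and a :: "real ^ 'n"
  assumes orth: "\<And>i j. i \<noteq> j \<Longrightarrow> orthogonal (row i U) (row j U)" and span: "span (rows U) = UNIV"
  shows "a = (\<Sum>i\<in>UNIV. ((a \<bullet> row i U) / (row i U \<bullet> row i U)) *\<^sub>R row i U)" (is "a = ?b")
proof -
  have "?b \<bullet> row j U = a \<bullet> row j U" for j
  proof -
    \<comment> \<open>At \<open>i = j\<close> the squared norm cancels; for a zero row both sides
      are 0, as division by zero yields 0.\<close>
    have "?b \<bullet> row j U = (\<Sum>i\<in>UNIV. if i = j then a \<bullet> row j U else 0)"
      unfolding inner_sum_left
      using orth by (intro sum.cong) (auto simp: orthogonal_def)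
    then show ?thesis by simp
  qed
  then have "orthogonal (a - ?b) x" if "x \<in> rows U" for x
    using that by (auto simp: rows_def orthogonal_def inner_diff_left)
  then have "orthogonal (a - ?b) (a - ?b)"
    using orthogonal_to_span[of "a - ?b" "rows U" "a - ?b"] span by (simp add: orthogonal_commute)
  then show ?thesis by (simp add: orthogonal_self)
qed

lemma orthogonal_eigenbasis_matrixD:
  assumes "orthogonal_eigenbasis_matrix m \<Lambda> U"
  shows "i \<noteq> j \<Longrightarrow> orthogonal (row i U) (row j U)"
    and "span (rows U) = UNIV"
    and "\<exists>j\<in>{1..m}. row i U \<in> \<Lambda> j"
    and "row i U \<in> \<Lambda> 1 \<Longrightarrow> row i U = 1"
  using assms by (simp_all add: orthogonal_eigenbasis_matrix_def)

text \<open>\<open>orthogonal_eigenbasis_matrix\<close> says what a row in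
  \<open>\<Lambda> 1\<close> looks like, while the existence of one comes from the rows spanning:
  otherwise all rows would be orthogonal to the vector 1, whose expansion would then vanish.\<close>

lemma ex_row_eq_one:
  assumes L: "eigenspace_order M m \<Lambda>" and M: "transpose M = M" and m: "1 \<le> m"
    and U: "orthogonal_eigenbasis_matrix m \<Lambda> U"
  obtains i where "row i U \<in> \<Lambda> 1" "row i U = 1"
proof -
  have one: "1 \<in> \<Lambda> 1" using L by (simp add: eigenspace_order_def span_base)
  have "\<exists>i. row i U \<in> \<Lambda> 1"
  proof (rule ccontr)
    assume none: "\<nexists>i. row i U \<in> \<Lambda> 1"
    have "1 \<bullet> row i U = 0" for i
    proof -
      obtain j where j: "j \<in> {1..m}" "row i U \<in> \<Lambda> j"
        using orthogonal_eigenbasis_matrixD(3)[OF U] by blast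
      with none have "1 \<noteq> j" by blast
      with j show ?thesis using eigenspace_order_orthogonal[OF L M _ j(1) _ one] m by simp
    qed
    then have "1 = (0 :: real ^ 'a)"
      using orthogonal_basis_expansion[OF orthogonal_eigenbasis_matrixD(1,2)[OF U], of 1] by simp
    then show False by simp
  qed
  then show ?thesis using that orthogonal_eigenbasis_matrixD(4)[OF U] by blast
qed

text \<open>Within \<open>{1..m}\<close> the complement of \<open>kbar m k\<close> is
  \<open>{2..k}\<close>. Hence rows that are not selected lie in the eigenspaces orthogonal to
  \<open>a\<close> and have coefficient 0, while selected rows lie in other eigenspaces and are
  orthogonal to all of these. The vector \<open>c\<close> collects the coefficients of the selected
  rows.\<close>

lemma orthogonal_eigenspaces_iff_selected_row_combination:
  fixes \<rho> :: "'r::finite \<Rightarrow> 'n::finite"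
  assumes L: "eigenspace_order M m \<Lambda>" and M: "transpose M = M" and k: "1 \<le> k" "k \<le> m"
    and U: "orthogonal_eigenbasis_matrix m \<Lambda> U"
    and \<rho>: "bij_betw \<rho> UNIV (selected_rows m \<Lambda> U k)"
  shows "(\<forall>i\<in>{2..k}. \<forall>\<phi>\<in>\<Lambda> i. a \<bullet> \<phi> = 0) \<longleftrightarrow>
    (\<exists>c. \<forall>v. a $ v = c \<bullet> column v (row_submatrix U \<rho>))"
proof
  let ?f = "\<lambda>i. (a \<bullet> row i U) / (row i U \<bullet> row i U)"
  let ?R = "selected_rows m \<Lambda> U k"
  assume a: "\<forall>i\<in>{2..k}. \<forall>\<phi>\<in>\<Lambda> i. a \<bullet> \<phi> = 0"
  have zero: "?f i = 0" if "i \<notin> ?R" for i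
  proof -
    obtain j where j: "j \<in> {1..m}" "row i U \<in> \<Lambda> j"
      using orthogonal_eigenbasis_matrixD(3)[OF U] by blast
    with that have "j \<notin> kbar m k" unfolding selected_rows_def by blast
    with j(1) have "j \<in> {2..k}" by (auto simp: kbar_def)
    with a j show ?thesis by auto
  qed
  have "a = (\<Sum>i\<in>UNIV. ?f i *\<^sub>R row i U)"
    by (rule orthogonal_basis_expansion[OF orthogonal_eigenbasis_matrixD(1,2)[OF U]])
  also have "\<dots> = (\<Sum>i\<in>?R. ?f i *\<^sub>R row i U)"
    by (rule sum.mono_neutral_right) (auto dest: zero)
  also have "\<dots> = (\<Sum>p\<in>UNIV. ?f (\<rho> p) *\<^sub>R row (\<rho> p) U)"
    by (rule sum.reindex_bij_betw[OF \<rho>, symmetric])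
  finally have *: "a = (\<Sum>p\<in>UNIV. ?f (\<rho> p) *\<^sub>R row (\<rho> p) U)" .
  have "a $ v = (\<chi> p. ?f (\<rho> p)) \<bullet> column v (row_submatrix U \<rho>)" for v
    by (subst *) (simp add: inner_vec_def column_def row_def row_submatrix_def)
  then show "\<exists>c. \<forall>v. a $ v = c \<bullet> column v (row_submatrix U \<rho>)" by blast
next
  assume "\<exists>c. \<forall>v. a $ v = c \<bullet> column v (row_submatrix U \<rho>)"
  then obtain c where c: "\<And>v. a $ v = c \<bullet> column v (row_submatrix U \<rho>)" by blast
  have a: "a = (\<Sum>p\<in>UNIV. (c $ p) *\<^sub>R row (\<rho> p) U)"
    by (simp add: vec_eq_iff c inner_vec_def column_def row_def row_submatrix_def)
  show "\<forall>i\<in>{2..k}. \<forall>\<phi>\<in>\<Lambda> i. a \<bullet> \<phi> = 0"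
  proof (intro ballI)
    fix i \<phi> assume i: "i \<in> {2..k}" and \<phi>: "\<phi> \<in> \<Lambda> i"
    have "row (\<rho> p) U \<bullet> \<phi> = 0" for p
    proof -
      have "\<rho> p \<in> selected_rows m \<Lambda> U k" using bij_betwE[OF \<rho>] by simp
      then obtain j where j: "j \<in> kbar m k" "row (\<rho> p) U \<in> \<Lambda> j" by (auto simp: selected_rows_def)
      then have "j \<in> {1..m}" "i \<in> {1..m}" "j \<noteq> i" using i k by (auto simp: kbar_def)
      then show ?thesis using eigenspace_order_orthogonal[OF L M] j(2) \<phi> by blast
    qed
    then show "a \<bullet> \<phi> = 0" unfolding a by (simp add: inner_sum_left)
  qed
qed

section \<open>Designs\<close>

text \<open>An eigenvector outside \<open>\<Lambda> 1\<close> is orthogonal to the vector 1, so its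
  mean is 0 and averaging it means orthogonality to the weights. Averaging
  \<open>\<Lambda> 1\<close> only fixes the scale, which can be adjusted as soon as the support is
  nonempty.\<close>

lemma positive_design_iff_orthogonal:
  assumes L: "eigenspace_order M m \<Lambda>" and M: "transpose M = M" and k: "1 \<le> k" "k \<le> m"
  shows "positive_design \<Lambda> k S \<longleftrightarrow>
    (\<exists>a :: real ^ 'n::finite. (\<forall>v. 0 \<le> a $ v) \<and> S = {v. 0 < a $ v} \<and> S \<noteq> {} \<and>
       (\<forall>i\<in>{2..k}. \<forall>\<phi>\<in>\<Lambda> i. a \<bullet> \<phi> = 0))"
proof -
  have one: "\<Lambda> 1 = span {1}" using L by (simp add: eigenspace_order_def)
  then have one_mem: "1 \<in> \<Lambda> 1" by (simp add: span_base)
  have sum0: "(\<Sum>v\<in>UNIV. \<phi> $ v) = 0" if "i \<in> {2..k}" "\<phi> \<in> \<Lambda> i" for i \<phi>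
  proof -
    have "1 \<bullet> \<phi> = 0"
      using that k by (intro eigenspace_order_orthogonal[OF L M _ _ _ one_mem]) auto
    then show ?thesis by (simp add: inner_vec_def)
  qed
  have av: "averages S b (\<Lambda> i) \<longleftrightarrow> (\<forall>s\<in>S. b s \<noteq> 0) \<and>
      (\<forall>\<phi>\<in>\<Lambda> i. (\<Sum>s\<in>S. b s * \<phi> $ s) = (1 / real CARD('n)) * (\<Sum>v\<in>UNIV. \<phi> $ v))"
    if "i \<in> {1..k}" for b i
    using that k by (intro averages_iff_all eigenspace_order_subspace[OF L M]) auto
  have inner: "(\<chi> v. if v \<in> S then b v else 0) \<bullet> \<phi> = (\<Sum>s\<in>S. b s * \<phi> $ s)" for b and \<phi> :: "real ^ 'n"
    by (simp add: inner_vec_def if_distrib[of "\<lambda>x. x * _"] sum.If_cases)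
  show ?thesis
  proof
    assume "positive_design \<Lambda> k S"
    then obtain b where b: "\<forall>s\<in>S. 0 < b s" "\<forall>i\<in>{1..k}. averages S b (\<Lambda> i)"
      unfolding positive_design_def by blast
    let ?a = "\<chi> v. if v \<in> S then b v else 0"
    \<comment> \<open>Averaging is applied to the vector 1, whose mean is 1.\<close>
    have "(\<Sum>s\<in>S. b s) = 1" using b(2) av[of 1 b] k one_mem by force
    then have "S \<noteq> {}" by auto
    moreover have "?a \<bullet> \<phi> = 0" if "i \<in> {2..k}" "\<phi> \<in> \<Lambda> i" for i \<phi>
      using b(2) av[of i b] that sum0[OF that] unfolding inner by auto
    ultimately show "\<exists>a. (\<forall>v. 0 \<le> a $ v) \<and> S = {v. 0 < a $ v} \<and> S \<noteq> {} \<and>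
       (\<forall>i\<in>{2..k}. \<forall>\<phi>\<in>\<Lambda> i. a \<bullet> \<phi> = 0)"
      using b(1) by (intro exI[of _ ?a]) (auto simp: less_imp_le)
  next
    assume "\<exists>a. (\<forall>v. 0 \<le> a $ v) \<and> S = {v. 0 < a $ v} \<and> S \<noteq> {} \<and>
       (\<forall>i\<in>{2..k}. \<forall>\<phi>\<in>\<Lambda> i. a \<bullet> \<phi> = 0)"
    then obtain a where a: "\<And>v. 0 \<le> a $ v" "S = {v. 0 < a $ v}" "S \<noteq> {}"
      "\<forall>i\<in>{2..k}. \<forall>\<phi>\<in>\<Lambda> i. a \<bullet> \<phi> = 0" by blast
    \<comment> \<open>The total mass \<open>t\<close> is the factor by which the weights are divided
      to meet the averaging condition on \<open>\<Lambda> 1\<close>; orthogonality survives the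
      scaling.\<close>
    define t where "t = (\<Sum>s\<in>S. a $ s)"
    have t: "t > 0" unfolding t_def using a(2,3) by (intro sum_pos) auto
    let ?b = "\<lambda>s. a $ s / t"
    have pos: "\<forall>s\<in>S. 0 < ?b s" using a(2) t by auto
    have av1: "(\<Sum>s\<in>S. ?b s * \<phi> $ s) = (1 / real CARD('n)) * (\<Sum>v\<in>UNIV. \<phi> $ v)"
      if \<phi>: "\<phi> \<in> \<Lambda> 1" for \<phi>
    proof -
      obtain r where r: "\<phi> = r *\<^sub>R 1" using \<phi> unfolding one span_singleton by (rule rangeE)
      have "(\<Sum>s\<in>S. ?b s * \<phi> $ s) = (\<Sum>s\<in>S. a $ s) * r / t"
        unfolding r by (simp add: sum_distrib_right sum_divide_distrib)
      then show ?thesis using t unfolding r by (simp add: t_def)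
    qed
    have "(\<chi> v. if v \<in> S then a $ v else 0) = a"
      using a(1) by (auto simp: vec_eq_iff a(2) less_le)
    then have "(\<Sum>s\<in>S. ?b s * \<phi> $ s) = (a \<bullet> \<phi>) / t" for \<phi>
      using inner[of "\<lambda>v. a $ v" \<phi>] by (simp add: sum_divide_distrib)
    then have av2: "(\<Sum>s\<in>S. ?b s * \<phi> $ s) = (1 / real CARD('n)) * (\<Sum>v\<in>UNIV. \<phi> $ v)"
      if "i \<in> {2..k}" "\<phi> \<in> \<Lambda> i" for i \<phi>
      using a(4) sum0[OF that] that by simp
    have "averages S ?b (\<Lambda> i)" if i: "i \<in> {1..k}" for i
    proof -
      have "\<forall>s\<in>S. ?b s \<noteq> 0" using pos by force
      moreover have "i = 1 \<or> i \<in> {2..k}" using i by auto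
      ultimately show ?thesis unfolding av[OF i] using av1 av2 by blast
    qed
    with pos show "positive_design \<Lambda> k S" unfolding positive_design_def by (intro exI[of _ ?b]) blast
  qed
qed

theorem theorem3p4:
  fixes E :: "'n::finite set set" and w :: "'n set \<Rightarrow> real"
    and m k :: nat and \<Lambda> :: "nat \<Rightarrow> (real ^ 'n) set"
    and U :: "real ^ 'n ^ 'n" and \<rho> :: "'r::finite \<Rightarrow> 'n"
    and V :: "real ^ 'n ^ 'r" and P :: "(real ^ 'r) set" and S :: "'n set"
  assumes "weighted_graph E w" and "graph_connected E"
    and "eigenspace_order (laplacian E w) m \<Lambda>"
    and "orthogonal_eigenbasis_matrix m \<Lambda> U"
    and "1 \<le> k" and "k \<le> m"
    and "bij_betw \<rho> UNIV (selected_rows m \<Lambda> U k)"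
    and "V = row_submatrix U \<rho>"
    and "P = design_polytope V"
  shows "(positive_design \<Lambda> k S \<longleftrightarrow>
            (\<exists>F. F face_of P \<and> F \<noteq> P \<and> UNIV - S = {i. column i V \<in> F})) \<and>
         (minimal_positive_design \<Lambda> k S \<longleftrightarrow>
            (\<exists>F. polytope_facet F P \<and> UNIV - S = {i. column i V \<in> F}))"
proof -
  note L = assms(3) and U = assms(4) and k = assms(5,6) and \<rho> = assms(7) and V = assms(8)
  note M = laplacian_symmetric[of E w]
  have P: "P = convex hull (range (\<lambda>v. column v V))"
    using assms(9) by (simp add: design_polytope_def)
  obtain i0 where i0: "row i0 U \<in> \<Lambda> 1" "row i0 U = 1"
    using ex_row_eq_one[OF L M _ U] k by force
  then have "i0 \<in> selected_rows m \<Lambda> U k" by (auto simp: selected_rows_def kbar_def)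
  then obtain p0 where p0: "\<rho> p0 = i0" using \<rho> by (metis bij_betw_imp_surj_on imageE)
  \<comment> \<open>The unit vector at the row of \<open>V\<close> that is constantly 1 picks the
    entry 1 from each column, so it serves as the \<open>e\<close> of
    \<open>proper_face_iff_nonneg_functional\<close>.\<close>
  have e: "axis p0 1 \<bullet> column v V = 1" for v
  proof -
    have "row i0 U $ v = 1" by (simp add: i0)
    then show ?thesis by (simp add: V inner_axis' column_def row_submatrix_def p0 row_def)
  qed
  have des: "positive_design \<Lambda> k T \<longleftrightarrow>
    (\<exists>F. F face_of P \<and> F \<noteq> P \<and> UNIV - T = {i. column i V \<in> F})" for T
  proof -
    have "positive_design \<Lambda> k T \<longleftrightarrow> (\<exists>a. (\<forall>v. 0 \<le> a $ v) \<and> T = {v. 0 < a $ v} \<and> T \<noteq> {} \<and>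
       (\<exists>c. \<forall>v. a $ v = c \<bullet> column v V))"
      unfolding positive_design_iff_orthogonal[OF L M k] V
        orthogonal_eigenspaces_iff_selected_row_combination[OF L M k U \<rho>] ..
    also have "\<dots> \<longleftrightarrow> (\<exists>c. (\<forall>v. 0 \<le> c \<bullet> column v V) \<and> T = {v. 0 < c \<bullet> column v V} \<and> T \<noteq> {})"
      (is "?A \<longleftrightarrow> ?C")
    proof
      assume ?C
      then obtain c where "\<forall>v. 0 \<le> c \<bullet> column v V" "T = {v. 0 < c \<bullet> column v V}" "T \<noteq> {}" by blast
      then show ?A by (intro exI[of _ "\<chi> v. c \<bullet> column v V"]) auto
    next
      assume ?A
      then obtain a c where "\<forall>v. 0 \<le> a $ v" "T = {v. 0 < a $ v}" "T \<noteq> {}"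
        "\<forall>v. a $ v = c \<bullet> column v V" by blast
      then show ?C by (intro exI[of _ c]) simp
    qed
    also have "\<dots> \<longleftrightarrow> (\<exists>F. F face_of P \<and> F \<noteq> P \<and> UNIV - T = {i. column i V \<in> F})"
      by (rule proper_face_iff_nonneg_functional[OF e P, symmetric])
    finally show ?thesis .
  qed
  have "minimal_positive_design \<Lambda> k S \<longleftrightarrow>
    (\<exists>F. polytope_facet F P \<and> UNIV - S = {i. column i V \<in> F})"
    unfolding minimal_positive_design_def
    by (rule minimal_complement_of_proper_face_iff_facet[OF P des])
  with des[of S] show ?thesis by (rule conjI)
qed

end
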